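(* Let $n\ge 1$ and let $X_1,\dots,X_n,Y$ be jointly distributed random variables with finite state sets and joint distribution $p$. Let $\mu$ be the uniform weighting $\mu(\gamma)=1/|\Gamma|$ on the set $\Gamma$ of maximal chains of the input lattice, and write $\mu(\mathfrak S,\mathfrak S')$ for the total weight of the maximal chains containing the edge $(\mathfrak S,\mathfrak S')$. Then for every $A\subseteq[n]$, the information contribution of $A$ equals the Shapley value under precedence constraints of $A$, regarded as a player in the cooperative game described in the context; precisely, $$\sum_{(\mathfrak S,\mathfrak S')\in\mathcal E_A}\mu(\mathfrak S,\mathfrak S')\,D_{\mathrm{KL}}(p_{\mathfrak S'}\|p_{\mathfrak S})=\sum_{\substack{\mathfrak S\in\mathcal D\\ A\in\mathfrak S^+}}\frac{|\mathcal R(\mathfrak S\setminus\{A\})|\cdot|\mathcal R(2^{[n]}\setminus\mathfrak S)|}{|\mathcal R(2^{[n]})|}\Bigl[D_{\mathrm{KL}}(p_{\mathfrak S}\|p_{\{\emptyset\}})-D_{\mathrm{KL}}(p_{\mathfrak S\setminus\{A\}}\|p_{\{\emptyset\}})\Bigr],$$ where the value $D_{\mathrm{KL}}(p_{\mathfrak S}\|p_{\{\emptyset\}})$ is taken to be $0$ when $\mathfrak S$ is the empty collection (so that the bracket is $0$ when $A=\emptyset$ and $\mathfrak S=\{\emptyset\}$).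
   Context: Sets of input variables are identified with index sets $A\subseteq[n]=\{1,\dots,n\}$. $D_{\mathrm{KL}}(q\|r)=\sum_z q(z)\log\frac{q(z)}{r(z)}$ is the Kullback-Leibler divergence and $H$ is Shannon entropy. Input lattice: the set of all non-empty simplicial complexes over $[n]$, i.e. non-empty sets $\mathfrak S$ of subsets of $[n]$ such that $A\in\mathfrak S$, $B\subseteq A$ imply $B\in\mathfrak S$, ordered by inclusion. Its bottom element is $\{\emptyset\}$ and its top element is $2^{[n]}$. Split distributions: for a non-empty simplicial complex $\mathfrak S$, let $M_{\mathfrak S}$ be the set of all joint probability distributions $q$ on the joint state space of $(X_1,\dots,X_n,Y)$ such that the marginal of $q$ on $(X_1,\dots,X_n)$ equals that of $p$ and, for every $A\in\mathfrak S$, the marginal of $q$ on $((X_i)_{i\in A},Y)$ equals that of $p$ (for $A=\emptyset$: the marginal on $Y$). Then $p_{\mathfrak S}=\operatorname{argmax}_{q\in M_{\mathfrak S}}H(q)$ is the unique maximum entropy element of $M_{\mathfrak S}$. Chains and edges: $\Gamma$ is the set of all maximal chains of the input lattice from $\{\emptyset\}$ to $2^{[n]}$. $\mathcal E_A$ is the set of pairs $(\mathfrak S,\mathfrak S')$ of non-empty simplicial complexes with $A\notin\mathfrak S$ and $\mathfrak S'=\mathfrak S\cup\{A\}$ (so $\mathcal E_\emptyset$ is empty, and an empty sum is $0$). $\Gamma(\mathfrak S,\mathfrak S')$ is the set of chains in $\Gamma$ in which $\mathfrak S,\mathfrak S'$ are consecutive, and $\mu(\mathfrak S,\mathfrak S')=\sum_{\gamma\in\Gamma(\mathfrak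 S,\mathfrak S')}\mu(\gamma)$. The information contribution of $A$ is the left-hand side of the claimed identity with $\mu$ uniform. Cooperative game: the players are the elements of $2^{[n]}$ (including $\emptyset$), partially ordered by inclusion. The feasible coalitions are the sets of players closed downwards under inclusion; $\mathcal D$ denotes the set of all of them, i.e. all simplicial complexes over $[n]$ together with the empty collection. The value of a coalition is $v(\mathfrak S)=D_{\mathrm{KL}}(p_{\mathfrak S}\|p_{\{\emptyset\}})$ for $\mathfrak S$ non-empty, and $v=0$ on the empty coalition. $A\in\mathfrak S^+$ means that $A\in\mathfrak S$ and $A$ is maximal in $\mathfrak S$ with respect to inclusion. For a set $\mathfrak P\subseteq 2^{[n]}$ of players, $\mathcal R(\mathfrak P)$ is the set of feasible rankings of $\mathfrak P$, i.e. bijections $\pi:\mathfrak P\to\{1,\dots,|\mathfrak P|\}$ such that $B\subsetneq C$ implies $\pi(B)<\pi(C)$ for $B,C\in\mathfrak P$; $|\mathcal R(\emptyset)|=1$. The Shapley value under precedence constraints (Faigle and Kern) of a player $A$ in a game $v$ is $$\Phi_A(v)=\frac{1}{|\mathcal R(2^{[n]})|}\sum_{\mathfrak S\in\mathcal D,\ A\in\mathfrak S^+}|\mathcal R(\mathfrak S\setminus\{A\})|\cdot|\mathcal R(2^{[n]}\setminus\mathfrak S)|\,\bigl(v(\mathfrak S)-v(\mathfrak S\setminus\{A\})\bigr),$$ which for the game above is the right-hand side of the claimed identity. *)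

theory Defs
  imports "HOL-Probability.Probability"
begin

section \<open>Divergence and entropy of discrete distributions\<close>

text \<open>
  Note the argument order: \<^const>\<open>KL_divergence\<close> takes the reference measure first.
  The base \<open>b > 1\<close> of the logarithm is a parameter.
\<close>

definition KL_pmf :: "real \<Rightarrow> 'z pmf \<Rightarrow> 'z pmf \<Rightarrow> real" where
  "KL_pmf b q r = KL_divergence b (measure_pmf r) (measure_pmf q)"

definition entropy_pmf :: "real \<Rightarrow> 'z pmf \<Rightarrow> real" where
  "entropy_pmf b q = prob_space.entropy (measure_pmf q) b (count_space UNIV) (\<lambda>z. z)"

text \<open>
  The two lemmas below confirm the familiar formulas for finitely supported distributions.
  The support condition on the divergence is needed because \<^const>\<open>KL_divergence\<close> is
  real-valued and hence never infinite.
\<close>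

lemma KL_pmf_eq_sum:
  assumes "1 < b" and fin: "finite (set_pmf q)" and sub: "set_pmf q \<subseteq> set_pmf r"
  shows "KL_pmf b q r = (\<Sum>z\<in>set_pmf q. pmf q z * log b (pmf q z / pmf r z))"
proof -
  define f where "f = (\<lambda>z. pmf q z / pmf r z)"
  have "measure_pmf q = density (measure_pmf r) (\<lambda>z. ennreal (f z))"
  proof -
    have "ennreal (pmf r z) * ennreal (f z) = ennreal (pmf q z)" for z
      using sub by (auto simp: f_def ennreal_mult[symmetric] set_pmf_iff)
    then show ?thesis
      by (simp add: measure_pmf_eq_density density_density_eq)
  qed
  then have "KL_pmf b q r = (\<integral>z. f z * log b (f z) \<partial>measure_pmf r)"
    unfolding KL_pmf_def using sigma_finite_measure.KL_density[OF measure_pmf.sigma_finite_measure_axioms assms(1), of f] by (simp add: f_def)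
  also have "\<dots> = (\<Sum>z\<in>set_pmf q. f z * log b (f z) * pmf r z)"
    using fin by (rule integral_measure_pmf_real) (auto simp: f_def set_pmf_iff)
  also have "\<dots> = (\<Sum>z\<in>set_pmf q. pmf q z * log b (pmf q z / pmf r z))"
    using sub by (intro sum.cong) (auto simp: f_def set_pmf_iff)
  finally show ?thesis .
qed

lemma entropy_pmf_eq_sum:
  assumes fin: "finite (set_pmf q)"
  shows "entropy_pmf b q = - (\<Sum>z\<in>set_pmf q. pmf q z * log b (pmf q z))"
proof -
  define g where "g = RN_deriv (count_space UNIV) (measure_pmf q)"
  have dens: "density (count_space UNIV) g = measure_pmf q"
    unfolding g_def
    by (subst (2) measure_pmf_eq_density, subst measure_pmf_eq_density)
       (rule density_RN_deriv_density, simp)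
  have g: "g z = ennreal (pmf q z)" for z
  proof -
    have "ennreal (pmf q z) = emeasure (density (count_space UNIV) g) {z}"
      by (simp add: dens emeasure_pmf_single)
    also have "\<dots> = g z"
      by (subst emeasure_density) (auto simp: nn_integral_indicator_singleton)
    finally show ?thesis by simp
  qed
  have "distr (measure_pmf q) (count_space UNIV) (\<lambda>z. z) = measure_pmf q"
    by (intro measure_eqI) (auto simp: emeasure_distr)
  then have "entropy_pmf b q = - (\<integral>z. log b (pmf q z) \<partial>measure_pmf q)"
    by (simp add: entropy_pmf_def prob_space.entropy_def[OF measure_pmf.prob_space_axioms] KL_divergence_def entropy_density_def
        comp_def g[unfolded g_def])
  also have "(\<integral>z. log b (pmf q z) \<partial>measure_pmf q) = (\<Sum>z\<in>set_pmf q. log b (pmf q z) * pmf q z)"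
    using fin by (rule integral_measure_pmf_real) auto
  finally show ?thesis by (simp add: mult.commute)
qed

section \<open>The input lattice\<close>

definition simplicial_complexes :: "nat \<Rightarrow> nat set set set" where
  "simplicial_complexes n = {K. K \<subseteq> Pow {1..n} \<and> (\<forall>A\<in>K. \<forall>B. B \<subseteq> A \<longrightarrow> B \<in> K)}"

definition input_lattice :: "nat \<Rightarrow> nat set set set" where
  "input_lattice n = simplicial_complexes n - {{}}"

text \<open>
  Chains are represented by their sets of elements. The lattice has a bottom and a top
  element, so that every inclusion-maximal chain runs from bottom to top.
\<close>

definition max_chains :: "nat \<Rightarrow> nat set set set set" where
  "max_chains n = {C. subset.maxchain (input_lattice n) C}"

definition max_chains_through ::
    "nat \<Rightarrow> nat set set \<Rightarrow> nat set set \<Rightarrow> nat set set set set" where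
  "max_chains_through n K K' =
     {C \<in> max_chains n. K \<in> C \<and> K' \<in> C \<and> K \<subset> K' \<and> \<not> (\<exists>L\<in>C. K \<subset> L \<and> L \<subset> K')}"

definition edge_weight ::
    "nat \<Rightarrow> (nat set set set \<Rightarrow> real) \<Rightarrow> nat set set \<Rightarrow> nat set set \<Rightarrow> real" where
  "edge_weight n \<mu> K K' = (\<Sum>C\<in>max_chains_through n K K'. \<mu> C)"

definition uniform_weighting :: "nat \<Rightarrow> nat set set set \<Rightarrow> real" where
  "uniform_weighting n C = 1 / real (card (max_chains n))"

definition edges :: "nat \<Rightarrow> nat set \<Rightarrow> (nat set set \<times> nat set set) set" where
  "edges n A = {(K, K'). K \<in> input_lattice n \<and> K' \<in> input_lattice n \<and>
                         A \<notin> K \<and> K' = K \<union> {A}}"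

section \<open>Split distributions and information contributions\<close>

text \<open>
  \<open>S i\<close> is the state set of the \<open>i\<close>-th input (for \<open>i \<in> {1..n}\<close>) and \<open>T\<close> that of the output.
  Input states are extensional functions on \<open>{1..n}\<close>.
\<close>

definition joint_states ::
    "nat \<Rightarrow> (nat \<Rightarrow> 'a set) \<Rightarrow> 'b set \<Rightarrow> ((nat \<Rightarrow> 'a) \<times> 'b) set" where
  "joint_states n S T = (\<Pi>\<^sub>E i\<in>{1..n}. S i) \<times> T"

definition input_marginal :: "((nat \<Rightarrow> 'a) \<times> 'b) pmf \<Rightarrow> (nat \<Rightarrow> 'a) pmf" where
  "input_marginal q = map_pmf fst q"

definition marginal :: "nat set \<Rightarrow> ((nat \<Rightarrow> 'a) \<times> 'b) pmf \<Rightarrow> ((nat \<Rightarrow> 'a) \<times> 'b) pmf" where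
  "marginal A q = map_pmf (\<lambda>(x, y). (restrict x A, y)) q"

definition split_family ::
    "nat \<Rightarrow> (nat \<Rightarrow> 'a set) \<Rightarrow> 'b set \<Rightarrow> ((nat \<Rightarrow> 'a) \<times> 'b) pmf \<Rightarrow> nat set set
      \<Rightarrow> ((nat \<Rightarrow> 'a) \<times> 'b) pmf set" where
  "split_family n S T p K =
     {q. set_pmf q \<subseteq> joint_states n S T \<and> input_marginal q = input_marginal p \<and>
         (\<forall>A\<in>K. marginal A q = marginal A p)}"

definition split_dist ::
    "real \<Rightarrow> nat \<Rightarrow> (nat \<Rightarrow> 'a set) \<Rightarrow> 'b set \<Rightarrow> ((nat \<Rightarrow> 'a) \<times> 'b) pmf \<Rightarrow> nat set set
      \<Rightarrow> ((nat \<Rightarrow> 'a) \<times> 'b) pmf" where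
  "split_dist b n S T p K = arg_max_on (entropy_pmf b) (split_family n S T p K)"

definition information_contribution ::
    "real \<Rightarrow> nat \<Rightarrow> (nat \<Rightarrow> 'a set) \<Rightarrow> 'b set \<Rightarrow> ((nat \<Rightarrow> 'a) \<times> 'b) pmf
      \<Rightarrow> (nat set set set \<Rightarrow> real) \<Rightarrow> nat set \<Rightarrow> real" where
  "information_contribution b n S T p \<mu> A =
     (\<Sum>(K, K')\<in>edges n A.
        edge_weight n \<mu> K K' * KL_pmf b (split_dist b n S T p K') (split_dist b n S T p K))"

section \<open>The Shapley value under precedence constraints\<close>

text \<open>
  Players are the subsets of \<open>{1..n}\<close>, ordered by inclusion; the feasible coalitions are
  exactly the elements of \<^const>\<open>simplicial_complexes\<close>, including the empty collection.
  Rankings are extensional functions, so that each is counted once.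
\<close>

definition feasible_rankings :: "nat set set \<Rightarrow> (nat set \<Rightarrow> nat) set" where
  "feasible_rankings P =
     {\<pi> \<in> extensional P. bij_betw \<pi> P {1..card P} \<and> (\<forall>B\<in>P. \<forall>C\<in>P. B \<subset> C \<longrightarrow> \<pi> B < \<pi> C)}"

definition maximal_elements :: "nat set set \<Rightarrow> nat set set" where
  "maximal_elements K = {A \<in> K. \<not> (\<exists>B\<in>K. A \<subset> B)}"

definition shapley_precedence :: "nat \<Rightarrow> (nat set set \<Rightarrow> real) \<Rightarrow> nat set \<Rightarrow> real" where
  "shapley_precedence n v A =
     (\<Sum>K\<in>{K \<in> simplicial_complexes n. A \<in> maximal_elements K}.
        real (card (feasible_rankings (K - {A}))) * real (card (feasible_rankings (Pow {1..n} - K)))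
          / real (card (feasible_rankings (Pow {1..n})))
          * (v K - v (K - {A})))"

definition information_game ::
    "real \<Rightarrow> nat \<Rightarrow> (nat \<Rightarrow> 'a set) \<Rightarrow> 'b set \<Rightarrow> ((nat \<Rightarrow> 'a) \<times> 'b) pmf
      \<Rightarrow> nat set set \<Rightarrow> real" where
  "information_game b n S T p K =
     (if K = {} then 0 else KL_pmf b (split_dist b n S T p K) (split_dist b n S T p {{}}))"

end

theory Submission
  imports Defs "HOL-Real_Asymp.Real_Asymp"
begin

text \<open>
  A maximum entropy element \<open>P\<close> of a family of distributions cut out by linear constraints has
  maximal support in the family, and the first-order condition at \<open>P\<close> makes the cross entropy of
  every member \<open>q\<close> relative to \<open>P\<close> equal to the entropy of \<open>P\<close>. Hence the divergence of \<open>q\<close> from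
  \<open>P\<close> is the entropy difference \<open>H(P) - H(q)\<close>. Since the split families shrink as the complex grows, the
  divergence along an edge is the difference of the values of the game at its ends.

  Sending a feasible ranking to the chain of its non-empty initial segments is a bijection onto the
  maximal chains. The rankings whose chain contains a given edge \<open>(K, K \<union> {A})\<close> consist of a ranking
  of \<open>K\<close>, then \<open>A\<close>, then a ranking of the rest, so that the edge weights are the Shapley coefficients.
\<close>

section \<open>Maximum entropy in linear families\<close>

text \<open>Equality of marginals means equality of the probabilities of fibres, so constraints on
  events are general enough to express the split families, and each of them is linear in the point
  masses.\<close>

definition linear_family :: "'z set \<Rightarrow> 'z set set \<Rightarrow> 'z pmf \<Rightarrow> 'z pmf set" where
  "linear_family J \<E> p =
     {q. set_pmf q \<subseteq> J \<and> (\<forall>X\<in>\<E>. measure_pmf.prob q X = measure_pmf.prob p X)}"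

lemma prob_eq_sum:
  assumes "finite J" "set_pmf q \<subseteq> J"
  shows "measure_pmf.prob q X = (\<Sum>z\<in>J \<inter> X. pmf q z)"
proof -
  have "measure_pmf.prob q X = measure_pmf.prob q (J \<inter> X)"
    using assms(2) by (metis measure_Int_set_pmf inf.absorb_iff2 inf_commute inf_left_commute)
  then show ?thesis
    using assms(1) by (simp add: measure_measure_pmf_finite)
qed

lemma obtain_pmf_of_weights:
  fixes f :: "'z \<Rightarrow> real"
  assumes "finite J" "\<And>z. 0 \<le> f z" "\<And>z. z \<notin> J \<Longrightarrow> f z = 0" "sum f J = 1"
  obtains q where "pmf q = f" "set_pmf q \<subseteq> J"
proof -
  have "(\<integral>\<^sup>+z. ennreal (f z) \<partial>count_space UNIV) = (\<Sum>z\<in>J. ennreal (f z))"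
    using assms(1,3) by (intro nn_integral_count_space'[OF assms(1)]) auto
  also have "\<dots> = 1"
    using assms by (simp add: sum_ennreal)
  finally have "pmf (embed_pmf f) = f"
    by (intro ext pmf_embed_pmf) (use assms in auto)
  moreover from this have "set_pmf (embed_pmf f) \<subseteq> J"
    using assms(3) by (metis pmf_eq_0_set_pmf subsetI)
  ultimately show thesis by (rule that)
qed

text \<open>Total mass and event probabilities are affine in \<open>t\<close>, with coefficients
  summing to 1. Asking for non-negative weights instead of \<open>t\<close> in [0,1] lets the
  segment be prolonged past its ends; the first-order condition uses negative
  \<open>t\<close>.\<close>

lemma linear_family_affine:
  assumes J: "finite J" and q: "q \<in> linear_family J \<E> p" and r: "r \<in> linear_family J \<E> p"
    and nonneg: "\<And>z. 0 \<le> (1 - t) * pmf q z + t * pmf r z"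
  shows "\<exists>s\<in>linear_family J \<E> p. \<forall>z. pmf s z = (1 - t) * pmf q z + t * pmf r z"
proof -
  let ?f = "\<lambda>z. (1 - t) * pmf q z + t * pmf r z"
  have sub: "set_pmf q \<subseteq> J" "set_pmf r \<subseteq> J"
    using q r by (auto simp: linear_family_def)
  have sum_f: "sum ?f (J \<inter> X) = (1 - t) * measure_pmf.prob q X + t * measure_pmf.prob r X" for X
    by (simp add: sum.distrib sum_distrib_left prob_eq_sum[OF J sub(1)] prob_eq_sum[OF J sub(2)])
  have "sum ?f J = 1"
    using sum_f[of UNIV] by simp
  moreover have "?f z = 0" if "z \<notin> J" for z
  proof -
    have "pmf q z = 0" "pmf r z = 0"
      using sub that by (auto simp: pmf_eq_0_set_pmf)
    then show ?thesis
      by simp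
  qed
  ultimately obtain s where s: "pmf s = ?f" "set_pmf s \<subseteq> J"
    using obtain_pmf_of_weights[OF J, of ?f] nonneg by blast
  have "measure_pmf.prob s X = measure_pmf.prob p X" if "X \<in> \<E>" for X
  proof -
    have "measure_pmf.prob s X = (1 - t) * measure_pmf.prob q X + t * measure_pmf.prob r X"
      by (simp only: prob_eq_sum[OF J s(2)] s(1) sum_f)
    also have "\<dots> = measure_pmf.prob p X"
      using q r that by (simp add: linear_family_def algebra_simps)
    finally show ?thesis .
  qed
  with s show ?thesis
    by (intro bexI[of _ s]) (auto simp: linear_family_def)
qed

section \<open>Continuity and convexity of \<open>x * ln x\<close>\<close>

lemma continuous_on_x_ln_x: "continuous_on {0..} (\<lambda>x::real. x * ln x)"
  unfolding continuous_on_def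
proof
  fix x :: real assume "x \<in> {0..}"
  show "((\<lambda>x. x * ln x) \<longlongrightarrow> x * ln x) (at x within {0..})"
  proof (cases "x = 0")
    case True
    \<comment> \<open>At 0 the product vanishes whatever \<open>ln 0\<close> is, in agreement with
      this one-sided limit; the faces of the simplex can thus take part in the compactness
      argument.\<close>
    have "((\<lambda>x::real. x * ln x) \<longlongrightarrow> 0) (at_right 0)"
      by real_asymp
    then show ?thesis
      using True by (simp add: at_within_Ici_at_right)
  next
    case False
    then show ?thesis
      by (intro tendsto_intros) auto
  qed
qed

text \<open>For positive \<open>x\<close> this is \<open>ln u \<le> u - 1\<close> at
  \<open>u = m / x\<close>, multiplied by \<open>x\<close>: the pointwise form of Gibbs'
  inequality.\<close>

lemma x_ln_x_diff_ge:
  fixes x m :: real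
  assumes "0 \<le> x" "0 < m"
  shows "x - m \<le> x * ln x - x * ln m"
proof (cases "x = 0")
  case False
  then have "x * ln (m / x) \<le> x * (m / x - 1)"
    using assms by (intro mult_left_mono ln_le_minus_one) auto
  then show ?thesis
    using False assms by (simp add: ln_div algebra_simps)
qed (use assms in auto)

text \<open>The pointwise inequality with reference \<open>m\<close> is averaged over
  \<open>x\<close> and \<open>y\<close>, and its linear terms cancel by the choice of
  \<open>m\<close>. No derivative enters, so \<open>y = 0\<close> is allowed.\<close>

lemma x_ln_x_convex:
  fixes x y t :: real
  assumes "0 < x" "0 \<le> y" "0 \<le> t" "t < 1"
  defines "m \<equiv> (1 - t) * x + t * y"
  shows "m * ln m \<le> (1 - t) * (x * ln x) + t * (y * ln y)"
proof -
  have m: "0 < m"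
    using assms by (simp add: add_pos_nonneg)
  have "(1 - t) * (x - m) + t * (y - m)
      \<le> (1 - t) * (x * ln x - x * ln m) + t * (y * ln y - y * ln m)"
    using assms m by (intro add_mono mult_left_mono x_ln_x_diff_ge) auto
  moreover have "(1 - t) * (x - m) + t * (y - m) = 0"
    by (simp add: m_def algebra_simps)
  moreover have "(1 - t) * (x * ln x - x * ln m) + t * (y * ln y - y * ln m)
      = (1 - t) * (x * ln x) + t * (y * ln y) - m * ln m"
    unfolding m_def by (simp add: algebra_simps)
  ultimately show ?thesis
    by linarith
qed

section \<open>Maximizers of the entropy in a linear family\<close>

lemma entropy_pmf_eq_sum_ln:
  assumes "finite J" "set_pmf q \<subseteq> J"
  shows "entropy_pmf b q = - (\<Sum>z\<in>J. pmf q z * ln (pmf q z)) / ln b"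
proof -
  have "entropy_pmf b q = - (\<Sum>z\<in>set_pmf q. pmf q z * log b (pmf q z))"
    using assms by (intro entropy_pmf_eq_sum) (rule finite_subset)
  \<comment> \<open>Summing over the fixed set \<open>J\<close> instead of the support makes
    entropies of different distributions comparable term by term.\<close>
  also have "\<dots> = - (\<Sum>z\<in>J. pmf q z * log b (pmf q z))"
    using assms by (intro arg_cong[where f = uminus] sum.mono_neutral_left) (auto simp: set_pmf_iff)
  finally show ?thesis
    by (simp add: log_def sum_divide_distrib)
qed

text \<open>The admissible weight vectors form a compact set, non-empty because it contains
  \<open>pmf p\<close>, on which the entropy is continuous.\<close>

lemma linear_family_maxent_exists:
  assumes b: "1 < b" and J: "finite J" and p: "set_pmf p \<subseteq> J"
  shows "\<exists>q. is_arg_max (entropy_pmf b) (\<lambda>q. q \<in> linear_family J \<E> p) q"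
proof -
  \<comment> \<open>Weights are functions on the whole type; pinning the coordinates outside
    \<open>J\<close> to 0 keeps every factor compact, so that Tychonoff's theorem applies.\<close>
  define B where "B = (\<lambda>z. if z \<in> J then {0..1::real} else {0})"
  define W where "W = Pi\<^sub>E UNIV B \<inter> ({f. sum f J = 1} \<inter> (\<Inter>X\<in>\<E>. {f. sum f (J \<inter> X) = measure_pmf.prob p X}))"
  have coord: "continuous_on UNIV (\<lambda>f::'a \<Rightarrow> real. f z)" for z
    by (rule continuous_on_product_coordinates)
  have "compact (Pi\<^sub>E UNIV B)"
    using compactin_PiE[of "\<lambda>_. euclidean" UNIV B] by (auto simp: B_def euclidean_product_topology)
  then have W: "compact W"
    unfolding W_def
    by (intro compact_Int_closed closed_Int closed_INT ballI closed_Collect_eq continuous_on_sum coord)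
       (auto intro!: continuous_intros)
  have pmf_W: "pmf q \<in> W" if "q \<in> linear_family J \<E> p" for q
  proof -
    have sub: "set_pmf q \<subseteq> J"
      using that by (simp add: linear_family_def)
    then have "sum (pmf q) J = 1"
      using prob_eq_sum[OF J sub, of UNIV] by simp
    then show ?thesis
      using that sub prob_eq_sum[OF J sub]
      by (auto simp: W_def B_def linear_family_def pmf_le_1 set_pmf_iff)
  qed
  have "p \<in> linear_family J \<E> p"
    using p by (simp add: linear_family_def)
  then have "W \<noteq> {}"
    using pmf_W by blast
  moreover have "continuous_on W (\<lambda>f. - (\<Sum>z\<in>J. f z * ln (f z)) / ln b)"
  proof -
    have "continuous_on W (\<lambda>f. f z * ln (f z))" if "z \<in> J" for z
    proof (rule continuous_on_compose2[OF continuous_on_x_ln_x])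
      show "continuous_on W (\<lambda>f. f z)"
        using coord continuous_on_subset by blast
      show "(\<lambda>f. f z) ` W \<subseteq> {0..}"
      proof (rule image_subsetI)
        fix f assume "f \<in> W"
        then have "f z \<in> B z"
          by (auto simp: W_def)
        then show "f z \<in> {0..}"
          using that by (simp add: B_def)
      qed
    qed
    then show ?thesis
      by (intro continuous_on_divide continuous_on_minus continuous_on_sum continuous_on_const)
        (use b in auto)
  qed
  ultimately obtain f where f: "f \<in> W"
    and max: "\<And>g. g \<in> W \<Longrightarrow> - (\<Sum>z\<in>J. g z * ln (g z)) / ln b \<le> - (\<Sum>z\<in>J. f z * ln (f z)) / ln b"
    by (meson continuous_attains_sup[OF W])
  have "f z \<in> B z" for z
    using f by (auto simp: W_def)
  then have "0 \<le> f z" "z \<notin> J \<Longrightarrow> f z = 0" for z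
    by (auto simp: B_def dest!: meta_spec[of _ z] split: if_splits)
  then obtain q where q: "pmf q = f" "set_pmf q \<subseteq> J"
    using obtain_pmf_of_weights[OF J, of f] f by (auto simp: W_def)
  then have q_in: "q \<in> linear_family J \<E> p"
    using f prob_eq_sum[OF J q(2)] by (auto simp: linear_family_def W_def)
  have "entropy_pmf b r \<le> entropy_pmf b q" if "r \<in> linear_family J \<E> p" for r
  proof -
    have "set_pmf r \<subseteq> J"
      using that by (simp add: linear_family_def)
    then show ?thesis
      using max[OF pmf_W[OF that]] by (simp add: entropy_pmf_eq_sum_ln[OF J] q)
  qed
  with q_in show ?thesis
    by (auto simp: is_arg_max_def not_less intro!: exI[of _ q])
qed

text \<open>The entropy has slope \<open>+\<infinity>\<close> at the boundary of the simplex, so a maximizer leaves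
  every face that the family allows it to leave.\<close>

lemma maxent_support:
  assumes b: "1 < b" and J: "finite J"
    and max: "is_arg_max (entropy_pmf b) (\<lambda>q. q \<in> linear_family J \<E> p) P"
    and q: "q \<in> linear_family J \<E> p"
  shows "set_pmf q \<subseteq> set_pmf P"
proof (rule ccontr)
  assume not_sub: "\<not> set_pmf q \<subseteq> set_pmf P"
  have P: "P \<in> linear_family J \<E> p"
    using max by (simp add: is_arg_max_def)
  have sub: "set_pmf P \<subseteq> J" "set_pmf q \<subseteq> J"
    using P q by (auto simp: linear_family_def)
  \<comment> \<open>The mass that \<open>q\<close> puts off the support of \<open>P\<close>. Below,
    \<open>H\<close> is the negated entropy up to the factor \<open>ln b\<close>.\<close>
  define m where "m = (\<Sum>z\<in>J - set_pmf P. pmf q z)"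
  define H where "H = (\<lambda>r. \<Sum>z\<in>J. pmf r z * ln (pmf r z))"
  have m: "0 < m"
  proof -
    obtain z where "z \<in> set_pmf q" "z \<notin> set_pmf P"
      using not_sub by blast
    then show ?thesis
      unfolding m_def using J sub by (intro sum_pos2[of _ z]) (auto simp: pmf_positive)
  qed
  \<comment> \<open>Compare \<open>P\<close> with the mixture at \<open>t\<close>. On the support of
    \<open>P\<close> convexity suffices; off it the mixture has weight \<open>t * pmf q z\<close>,
    whose logarithm splits off \<open>ln t\<close>. Dividing by \<open>t\<close> leaves this
    bound.\<close>
  have bound: "H P - H q \<le> m * ln t" if t: "0 < t" "t < 1" for t
  proof -
    have "0 \<le> (1 - t) * pmf P z + t * pmf q z" for z
      using t by simp
    then obtain s where s: "s \<in> linear_family J \<E> p"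
      "\<And>z. pmf s z = (1 - t) * pmf P z + t * pmf q z"
      using linear_family_affine[OF J P q] by blast
    have "entropy_pmf b s \<le> entropy_pmf b P"
      using max s(1) by (auto simp: is_arg_max_def not_less)
    moreover have "set_pmf s \<subseteq> J"
      using s(1) by (simp add: linear_family_def)
    ultimately have "H P \<le> H s"
      using b sub(1) by (simp add: entropy_pmf_eq_sum_ln[OF J] H_def divide_le_cancel)
    also have "H s \<le> (\<Sum>z\<in>J. (1 - t) * (pmf P z * ln (pmf P z)) + t * (pmf q z * ln (pmf q z))
        + (if z \<in> set_pmf P then 0 else t * pmf q z * ln t))"
      unfolding H_def
    proof (rule sum_mono)
      fix z
      show "pmf s z * ln (pmf s z) \<le> (1 - t) * (pmf P z * ln (pmf P z)) + t * (pmf q z * ln (pmf q z))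
        + (if z \<in> set_pmf P then 0 else t * pmf q z * ln t)"
      proof (cases "z \<in> set_pmf P")
        case True
        then show ?thesis
          using x_ln_x_convex[of "pmf P z" "pmf q z" t] t by (simp add: s(2) pmf_positive)
      next
        case False
        then have "pmf P z = 0"
          by (simp add: set_pmf_iff)
        then show ?thesis
          using False t by (cases "pmf q z = 0") (simp_all add: s(2) ln_mult algebra_simps)
      qed
    qed
    also have "\<dots> = (1 - t) * H P + t * H q + t * (m * ln t)"
    proof -
      have "(\<Sum>z\<in>J. if z \<in> set_pmf P then 0 else t * pmf q z * ln t)
          = (\<Sum>z\<in>J - set_pmf P. t * pmf q z * ln t)"
        using J by (intro sum.mono_neutral_cong_right) auto
      also have "\<dots> = t * (m * ln t)"
        by (simp add: m_def sum_distrib_left sum_distrib_right mult.assoc)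
      finally show ?thesis
        by (simp add: sum.distrib H_def sum_distrib_left)
    qed
    finally have "t * (H P - H q) \<le> t * (m * ln t)"
      by (simp add: algebra_simps)
    then show ?thesis
      using t by simp
  qed
  \<comment> \<open>The left side of \<open>bound\<close> is constant, while the right side is
    unbounded below as \<open>t\<close> tends to 0.\<close>
  have "filterlim (\<lambda>t. m * ln t) at_bot (at_right 0)"
    using m by real_asymp
  then have "eventually (\<lambda>t. m * ln t < H P - H q) (at_right 0)"
    by (simp add: filterlim_at_bot_dense)
  moreover have "eventually (\<lambda>t::real. t \<in> {0<..<1}) (at_right 0)"
    by (rule eventually_at_right_real) simp
  ultimately have "eventually (\<lambda>t::real. False) (at_right 0)"
    by eventually_elim (use bound in force)
  then show False
    by simp
qed

text \<open>Since the support of \<open>q\<close> lies in that of \<open>P\<close>, the line through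
  \<open>P\<close> and \<open>q\<close> stays in the family for small \<open>t\<close> of both
  signs. The entropy along it has an interior maximum at \<open>t = 0\<close>, so its derivative
  there is 0.\<close>

lemma maxent_cross_entropy:
  assumes b: "1 < b" and J: "finite J"
    and max: "is_arg_max (entropy_pmf b) (\<lambda>q. q \<in> linear_family J \<E> p) P"
    and q: "q \<in> linear_family J \<E> p"
  shows "(\<Sum>z\<in>J. pmf q z * ln (pmf P z)) = (\<Sum>z\<in>J. pmf P z * ln (pmf P z))"
proof -
  have P: "P \<in> linear_family J \<E> p"
    using max by (simp add: is_arg_max_def)
  have sub: "set_pmf P \<subseteq> J" "set_pmf q \<subseteq> set_pmf P"
    using P maxent_support[OF assms] by (auto simp: linear_family_def)
  define A where "A = set_pmf P"
  have A: "finite A" "A \<subseteq> J"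
    using sub J finite_subset by (auto simp: A_def)
  have pos: "0 < pmf P z" if "z \<in> A" for z
    using that by (simp add: A_def pmf_positive)
  have zero: "pmf P z = 0" "pmf q z = 0" if "z \<notin> A" for z
    using that sub by (auto simp: A_def set_pmf_iff)
  define f where "f = (\<lambda>t z. (1 - t) * pmf P z + t * pmf q z)"
  define \<phi> where "\<phi> = (\<lambda>t. - (\<Sum>z\<in>A. f t z * ln (f t z)))"
  \<comment> \<open>At \<open>t = 0\<close> the weights on the finite set \<open>A\<close> are those
    of \<open>P\<close>, hence positive, and they stay positive on a two-sided
    neighbourhood.\<close>
  have ev: "eventually (\<lambda>t. \<forall>z\<in>A. 0 < f t z) (nhds 0)"
  proof (intro eventually_ball_finite A ballI)
    fix z assume "z \<in> A"
    have "((\<lambda>t. f t z) \<longlongrightarrow> f 0 z) (nhds 0)"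
      unfolding f_def by (intro tendsto_intros filterlim_ident)
    then show "eventually (\<lambda>t. 0 < f t z) (nhds 0)"
      using pos[OF \<open>z \<in> A\<close>] by (intro order_tendstoD(1)) (simp_all add: f_def)
  qed
  then obtain d where d: "0 < d" "\<And>t. \<bar>t\<bar> < d \<Longrightarrow> \<forall>z\<in>A. 0 < f t z"
    by (auto simp: eventually_nhds_metric dist_real_def)
  have "\<phi> t \<le> \<phi> 0" if "\<bar>0 - t\<bar> < d" for t
  proof -
    have "0 \<le> f t z" for z
      using d(2)[of t] that zero[of z] by (cases "z \<in> A") (auto simp: f_def less_imp_le)
    then obtain s where s: "s \<in> linear_family J \<E> p" "\<And>z. pmf s z = f t z"
      using linear_family_affine[OF J P q, of t] by (auto simp: f_def)
    have eq: "entropy_pmf b r = - (\<Sum>z\<in>A. pmf r z * ln (pmf r z)) / ln b"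
      if "\<And>z. z \<notin> A \<Longrightarrow> pmf r z = 0" for r
      using that by (intro entropy_pmf_eq_sum_ln A) (metis pmf_eq_0_set_pmf subsetI)
    have "entropy_pmf b s \<le> entropy_pmf b P"
      using max s(1) by (auto simp: is_arg_max_def not_less)
    moreover have "pmf s z = 0" if "z \<notin> A" for z
      using zero[OF that] by (simp add: s(2) f_def)
    ultimately show ?thesis
      using b by (simp add: eq zero \<phi>_def s(2) divide_le_cancel) (simp add: f_def)
  qed
  moreover have "(\<phi> has_real_derivative - (\<Sum>z\<in>A. (pmf q z - pmf P z) * (ln (pmf P z) + 1))) (at 0)"
    unfolding \<phi>_def
  proof (intro DERIV_minus DERIV_sum)
    fix z assume "z \<in> A"
    have f0: "f 0 z = pmf P z"
      by (simp add: f_def)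
    have deriv: "((\<lambda>t. f t z) has_real_derivative pmf q z - pmf P z) (at 0)"
      unfolding f_def by (rule derivative_eq_intros refl | simp)+
    have "((\<lambda>t. f t z * ln (f t z)) has_real_derivative
        (pmf q z - pmf P z) * ln (f 0 z) + 1 / f 0 z * (pmf q z - pmf P z) * f 0 z) (at 0)"
      using pos[OF \<open>z \<in> A\<close>] by (intro DERIV_mult deriv DERIV_ln_divide[THEN DERIV_chain2]) (simp add: f0)
    then show "((\<lambda>t. f t z * ln (f t z)) has_real_derivative
        (pmf q z - pmf P z) * (ln (pmf P z) + 1)) (at 0)"
      using pos[OF \<open>z \<in> A\<close>] by (simp add: f0 algebra_simps)
  qed
  ultimately have "- (\<Sum>z\<in>A. (pmf q z - pmf P z) * (ln (pmf P z) + 1)) = 0"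
    using DERIV_local_max d(1) by blast
  \<comment> \<open>Equal total masses cancel the summand 1 in the derivative
    \<open>ln x + 1\<close> of \<open>x * ln x\<close>.\<close>
  moreover have "sum (pmf q) A = 1" "sum (pmf P) A = 1"
    using sub A by (auto intro!: sum_pmf_eq_1 simp: A_def)
  ultimately have "(\<Sum>z\<in>A. pmf q z * ln (pmf P z)) = (\<Sum>z\<in>A. pmf P z * ln (pmf P z))"
    by (simp add: algebra_simps sum.distrib sum_subtractf)
  moreover have "(\<Sum>z\<in>J. pmf r z * ln (pmf P z)) = (\<Sum>z\<in>A. pmf r z * ln (pmf P z))" for r
    using A J zero by (intro sum.mono_neutral_right) auto
  ultimately show ?thesis
    by simp
qed

text \<open>Splitting the logarithm yields the cross entropy of \<open>q\<close> relative to
  \<open>P\<close>, which is the entropy of \<open>P\<close>, minus the entropy of \<open>q\<close>.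
  The inclusion of supports makes the divergence equal to the finite sum.\<close>

lemma KL_maxent_eq_entropy_diff:
  assumes b: "1 < b" and J: "finite J"
    and max: "is_arg_max (entropy_pmf b) (\<lambda>q. q \<in> linear_family J \<E> p) P"
    and q: "q \<in> linear_family J \<E> p"
  shows "KL_pmf b q P = entropy_pmf b P - entropy_pmf b q"
proof -
  have subJ: "set_pmf P \<subseteq> J" "set_pmf q \<subseteq> J"
    using max q by (auto simp: linear_family_def is_arg_max_def)
  have sub: "set_pmf q \<subseteq> set_pmf P"
    by (rule maxent_support[OF assms])
  have fin: "finite (set_pmf q)"
    using subJ J finite_subset by blast
  have "KL_pmf b q P = (\<Sum>z\<in>set_pmf q. pmf q z * log b (pmf q z / pmf P z))"
    by (rule KL_pmf_eq_sum[OF b fin sub])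
  also have "\<dots> = (\<Sum>z\<in>set_pmf q. (pmf q z * ln (pmf q z) - pmf q z * ln (pmf P z)) / ln b)"
  proof (intro sum.cong refl)
    fix z assume "z \<in> set_pmf q"
    then have "0 < pmf q z" "0 < pmf P z"
      using sub by (auto intro: pmf_positive)
    then show "pmf q z * log b (pmf q z / pmf P z) =
        (pmf q z * ln (pmf q z) - pmf q z * ln (pmf P z)) / ln b"
      by (simp add: log_def ln_div algebra_simps)
  qed
  also have "\<dots> = (\<Sum>z\<in>J. (pmf q z * ln (pmf q z) - pmf q z * ln (pmf P z)) / ln b)"
    using J subJ by (intro sum.mono_neutral_left) (auto simp: set_pmf_iff)
  also have "\<dots> = ((\<Sum>z\<in>J. pmf q z * ln (pmf q z)) - (\<Sum>z\<in>J. pmf q z * ln (pmf P z))) / ln b"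
    by (simp add: sum_divide_distrib sum_subtractf diff_divide_distrib)
  also have "\<dots> = entropy_pmf b P - entropy_pmf b q"
    by (simp add: maxent_cross_entropy[OF assms] entropy_pmf_eq_sum_ln[OF J subJ(1)]
        entropy_pmf_eq_sum_ln[OF J subJ(2)] diff_divide_distrib)
  finally show ?thesis .
qed

section \<open>Split families as linear families\<close>

lemma map_pmf_eq_iff_prob:
  "map_pmf g q = map_pmf g p \<longleftrightarrow>
     (\<forall>w. measure_pmf.prob q (g -` {w}) = measure_pmf.prob p (g -` {w}))"
  by (simp add: pmf_eq_iff pmf_map)

text \<open>The fibres of the marginal maps: the first part fixes the joint law of the inputs, the
  second the law of the inputs in \<open>A\<close> together with the output.\<close>

definition marginal_events :: "nat set set \<Rightarrow> ((nat \<Rightarrow> 'a) \<times> 'b) set set" where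
  "marginal_events K = range (\<lambda>x. fst -` {x}) \<union>
     (\<Union>A\<in>K. range (\<lambda>w. (\<lambda>(x, y). (restrict x A, y)) -` {w}))"

lemma split_family_eq_linear_family:
  "split_family n S T p K = linear_family (joint_states n S T) (marginal_events K) p"
  unfolding split_family_def linear_family_def input_marginal_def marginal_def
    map_pmf_eq_iff_prob marginal_events_def
  by (simp add: ball_Un del: split_paired_All)

lemma finite_joint_states:
  assumes "\<And>i. i \<in> {1..n} \<Longrightarrow> finite (S i)" "finite T"
  shows "finite (joint_states n S T)"
  unfolding joint_states_def
  by (intro finite_cartesian_product finite_PiE finite_atLeastAtMost assms)

text \<open>The choice operator behind \<open>arg_max_on\<close> returns an actual maximizer as soon
  as one exists.\<close>

lemma split_dist_maxent:
  assumes "1 < b" "finite (joint_states n S T)" "set_pmf p \<subseteq> joint_states n S T"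
  shows "is_arg_max (entropy_pmf b) (\<lambda>q. q \<in> split_family n S T p K) (split_dist b n S T p K)"
  using linear_family_maxent_exists[OF assms]
  unfolding split_dist_def arg_max_on_def arg_max_def split_family_eq_linear_family
  by (rule someI_ex)

text \<open>The maximizer for \<open>K'\<close> satisfies the fewer constraints of \<open>K\<close>,
  so it is a member of the family maximized by the reference distribution. This covers edges as well
  as comparisons with \<open>{{}}\<close>.\<close>

lemma KL_split_dist:
  assumes "1 < b" "finite (joint_states n S T)" "set_pmf p \<subseteq> joint_states n S T" "K \<subseteq> K'"
  shows "KL_pmf b (split_dist b n S T p K') (split_dist b n S T p K) =
         entropy_pmf b (split_dist b n S T p K) - entropy_pmf b (split_dist b n S T p K')"
proof (rule KL_maxent_eq_entropy_diff[OF assms(1,2)])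
  show "is_arg_max (entropy_pmf b)
      (\<lambda>q. q \<in> linear_family (joint_states n S T) (marginal_events K) p) (split_dist b n S T p K)"
    using split_dist_maxent[OF assms(1-3)] by (simp add: split_family_eq_linear_family)
  have "split_dist b n S T p K' \<in> split_family n S T p K'"
    using split_dist_maxent[OF assms(1-3)] by (simp add: is_arg_max_def)
  then have "split_dist b n S T p K' \<in> split_family n S T p K"
    using assms(4) by (auto simp: split_family_def)
  then show "split_dist b n S T p K'
      \<in> linear_family (joint_states n S T) (marginal_events K) p"
    by (simp add: split_family_eq_linear_family)
qed

section \<open>Feasible rankings and maximal chains\<close>

definition ranking_prefix :: "nat set set \<Rightarrow> (nat set \<Rightarrow> nat) \<Rightarrow> nat \<Rightarrow> nat set set" where
  "ranking_prefix P \<pi> k = {A \<in> P. \<pi> A \<le> k}"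

lemma ranking_prefix_mono: "k \<le> l \<Longrightarrow> ranking_prefix P \<pi> k \<subseteq> ranking_prefix P \<pi> l"
  by (auto simp: ranking_prefix_def)

lemma image_ranking_prefix:
  assumes \<pi>: "bij_betw \<pi> P {1..card P}" and k: "k \<le> card P"
  shows "\<pi> ` ranking_prefix P \<pi> k = {1..k}"
proof
  show "\<pi> ` ranking_prefix P \<pi> k \<subseteq> {1..k}"
    using bij_betw_apply[OF \<pi>] by (auto simp: ranking_prefix_def)
  show "{1..k} \<subseteq> \<pi> ` ranking_prefix P \<pi> k"
  proof
    fix i assume i: "i \<in> {1..k}"
    then have "i \<in> \<pi> ` P"
      using \<pi> k by (simp add: bij_betw_def)
    then show "i \<in> \<pi> ` ranking_prefix P \<pi> k"
      using i by (auto simp: ranking_prefix_def)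
  qed
qed

lemma card_ranking_prefix:
  assumes "bij_betw \<pi> P {1..card P}" "k \<le> card P"
  shows "card (ranking_prefix P \<pi> k) = k"
proof -
  have "inj_on \<pi> (ranking_prefix P \<pi> k)"
    using assms(1) by (auto simp: bij_betw_def ranking_prefix_def intro: inj_on_subset)
  then show ?thesis
    using image_ranking_prefix[OF assms] by (metis card_image card_atLeastAtMost diff_Suc_1)
qed

text \<open>The position of a player is the least index of a prefix that contains it.\<close>

lemma ranking_prefix_eq_imp_eq:
  assumes "bij_betw \<pi> P {1..card P}" "bij_betw \<sigma> P {1..card P}"
    and eq: "\<And>k. k \<in> {1..card P} \<Longrightarrow> ranking_prefix P \<pi> k = ranking_prefix P \<sigma> k"
    and A: "A \<in> P"
  shows "\<pi> A = \<sigma> A"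
proof -
  have "\<pi> A \<in> {1..card P}" "\<sigma> A \<in> {1..card P}"
    using assms bij_betw_apply by fast+
  then have "\<pi> A \<le> \<sigma> A" "\<sigma> A \<le> \<pi> A"
    using eq[of "\<pi> A"] eq[of "\<sigma> A"] A by (auto simp: ranking_prefix_def)
  then show ?thesis
    by simp
qed

section \<open>Simplicial complexes and the chain of a ranking\<close>

lemma finite_simplicial_complex: "K \<in> simplicial_complexes n \<Longrightarrow> finite K"
  by (auto simp: simplicial_complexes_def intro: finite_subset)

lemma card_simplicial_complex_le: "K \<in> simplicial_complexes n \<Longrightarrow> card K \<le> card (Pow {1..n})"
  by (auto simp: simplicial_complexes_def intro!: card_mono)

lemma finite_simplicial_complexes: "finite (simplicial_complexes n)"
  by (rule finite_subset[of _ "Pow (Pow {1..n})"]) (auto simp: simplicial_complexes_def)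

lemma Pow_in_simplicial_complexes: "Pow {1..n} \<in> simplicial_complexes n"
  by (auto simp: simplicial_complexes_def)

lemma empty_set_in_input_lattice: "K \<in> input_lattice n \<Longrightarrow> {} \<in> K"
  by (auto simp: input_lattice_def simplicial_complexes_def)

lemma ranking_prefix_simplicial:
  assumes "\<pi> \<in> feasible_rankings (Pow {1..n})"
  shows "ranking_prefix (Pow {1..n}) \<pi> k \<in> simplicial_complexes n"
proof -
  have "\<pi> B \<le> \<pi> A" if "A \<subseteq> {1..n}" "B \<subseteq> A" for A B
    using assms that by (cases "B = A") (auto simp: feasible_rankings_def less_imp_le psubset_eq)
  then have "B \<in> ranking_prefix (Pow {1..n}) \<pi> k"
    if "A \<in> ranking_prefix (Pow {1..n}) \<pi> k" "B \<subseteq> A" for A B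
    using that unfolding ranking_prefix_def by (blast intro: order_trans)
  moreover have "ranking_prefix (Pow {1..n}) \<pi> k \<subseteq> Pow {1..n}"
    by (auto simp: ranking_prefix_def)
  ultimately show ?thesis
    unfolding simplicial_complexes_def by blast
qed

text \<open>Indices start at 1 because the prefix at 0 is the empty collection, which is outside the
  input lattice.\<close>

definition ranking_chain :: "nat \<Rightarrow> (nat set \<Rightarrow> nat) \<Rightarrow> nat set set set" where
  "ranking_chain n \<pi> = ranking_prefix (Pow {1..n}) \<pi> ` {1..card (Pow {1..n})}"

text \<open>The prefix at \<open>k\<close> has \<open>k\<close> elements, so only the one at
  \<open>card K\<close> can equal \<open>K\<close>.\<close>

lemma ranking_chain_iff:
  assumes "\<pi> \<in> feasible_rankings (Pow {1..n})" "K \<in> input_lattice n"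
  shows "K \<in> ranking_chain n \<pi> \<longleftrightarrow> ranking_prefix (Pow {1..n}) \<pi> (card K) = K"
proof
  assume "K \<in> ranking_chain n \<pi>"
  then obtain k where "k \<le> card (Pow {1..n})" "K = ranking_prefix (Pow {1..n}) \<pi> k"
    by (auto simp: ranking_chain_def)
  then show "ranking_prefix (Pow {1..n}) \<pi> (card K) = K"
    using assms(1) card_ranking_prefix by (auto simp: feasible_rankings_def)
next
  assume *: "ranking_prefix (Pow {1..n}) \<pi> (card K) = K"
  have "K \<in> simplicial_complexes n" "K \<noteq> {}"
    using assms(2) by (auto simp: input_lattice_def)
  then have "card K \<in> {1..card (Pow {1..n})}"
    using finite_simplicial_complex card_simplicial_complex_le
    by (auto simp: Suc_le_eq card_gt_0_iff)
  then show "K \<in> ranking_chain n \<pi>"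
    unfolding ranking_chain_def using * by (metis image_eqI)
qed

lemma ranking_chain_subset:
  assumes "\<pi> \<in> feasible_rankings (Pow {1..n})"
  shows "ranking_chain n \<pi> \<subseteq> input_lattice n"
proof -
  have "ranking_prefix (Pow {1..n}) \<pi> k \<noteq> {}" if "k \<in> {1..card (Pow {1..n})}" for k
    using card_ranking_prefix[of \<pi> "Pow {1..n}" k] assms that
    by (auto simp: feasible_rankings_def)
  then show ?thesis
    using ranking_prefix_simplicial[OF assms] by (auto simp: ranking_chain_def input_lattice_def)
qed

text \<open>The prefixes are nested and attain every size. A complex comparable with all of them is
  comparable with the one of its own size, hence equal to it.\<close>

lemma ranking_chain_in_max_chains:
  assumes \<pi>: "\<pi> \<in> feasible_rankings (Pow {1..n})"
  shows "ranking_chain n \<pi> \<in> max_chains n"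
proof -
  have linear: "subset.chain (input_lattice n) (ranking_chain n \<pi>)"
    unfolding subset_chain_def
  proof (intro conjI ballI ranking_chain_subset[OF \<pi>])
    fix X Y assume "X \<in> ranking_chain n \<pi>" "Y \<in> ranking_chain n \<pi>"
    then obtain k l where "X = ranking_prefix (Pow {1..n}) \<pi> k" "Y = ranking_prefix (Pow {1..n}) \<pi> l"
      by (auto simp: ranking_chain_def)
    then show "X \<subseteq> Y \<or> Y \<subseteq> X"
      using ranking_prefix_mono nat_le_linear by metis
  qed
  moreover have "C \<subseteq> ranking_chain n \<pi>"
    if C: "subset.chain (input_lattice n) C" and sub: "ranking_chain n \<pi> \<subseteq> C" for C
  proof
    fix K assume "K \<in> C"
    then have K: "K \<in> input_lattice n"
      using C by (auto simp: subset_chain_def)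
    then have K': "K \<in> simplicial_complexes n" "K \<noteq> {}"
      by (auto simp: input_lattice_def)
    define L where "L = ranking_prefix (Pow {1..n}) \<pi> (card K)"
    have "card L = card K"
      using \<pi> card_simplicial_complex_le[OF K'(1)]
      by (auto simp: L_def feasible_rankings_def intro: card_ranking_prefix)
    moreover have "card K \<in> {1..card (Pow {1..n})}"
      using K' finite_simplicial_complex card_simplicial_complex_le
      by (auto simp: Suc_le_eq card_gt_0_iff)
    then have "L \<in> ranking_chain n \<pi>"
      unfolding L_def ranking_chain_def by (rule imageI)
    moreover from this have "L \<subseteq> K \<or> K \<subseteq> L"
      using C sub \<open>K \<in> C\<close> unfolding subset_chain_def by blast
    moreover have "finite K" "finite L"
      using K' ranking_prefix_simplicial[OF \<pi>] finite_simplicial_complex unfolding L_def by blast+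
    ultimately have "K = L"
      by (metis card_subset_eq)
    then show "K \<in> ranking_chain n \<pi>"
      using \<open>L \<in> _\<close> by simp
  qed
  ultimately show ?thesis
    by (auto simp: max_chains_def subset.maxchain_def)
qed

text \<open>The member of size \<open>k\<close> in the chain is the prefix at \<open>k\<close>, so
  the chain determines all prefixes and these determine the ranking.\<close>

lemma inj_on_ranking_chain: "inj_on (ranking_chain n) (feasible_rankings (Pow {1..n}))"
proof (rule inj_onI)
  let ?P = "Pow {1..n}"
  fix \<pi> \<sigma> assume \<pi>: "\<pi> \<in> feasible_rankings ?P" and \<sigma>: "\<sigma> \<in> feasible_rankings ?P"
    and eq: "ranking_chain n \<pi> = ranking_chain n \<sigma>"
  have bij: "bij_betw \<pi> ?P {1..card ?P}" "bij_betw \<sigma> ?P {1..card ?P}"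
    using \<pi> \<sigma> by (auto simp: feasible_rankings_def)
  have "ranking_prefix ?P \<pi> k = ranking_prefix ?P \<sigma> k" if k: "k \<in> {1..card ?P}" for k
  proof -
    have "ranking_prefix ?P \<pi> k \<in> ranking_chain n \<sigma>"
      unfolding eq[symmetric] using k by (simp add: ranking_chain_def)
    moreover have "card (ranking_prefix ?P \<pi> k) = k"
      using card_ranking_prefix[OF bij(1)] k by simp
    ultimately show ?thesis
      using ranking_chain_iff[OF \<sigma>] ranking_chain_subset[OF \<sigma>] by (metis subsetD)
  qed
  then have "\<pi> A = \<sigma> A" if "A \<in> ?P" for A
    using ranking_prefix_eq_imp_eq[OF bij] that by blast
  then show "\<pi> = \<sigma>"
    using \<pi> \<sigma> by (intro extensionalityI[of _ ?P]) (auto simp: feasible_rankings_def)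
qed

section \<open>From maximal chains to rankings\<close>

lemma simplicial_complex_Union:
  "\<C> \<subseteq> simplicial_complexes n \<Longrightarrow> \<Union>\<C> \<in> simplicial_complexes n"
  unfolding simplicial_complexes_def by blast

text \<open>Take \<open>A\<close> inclusion-minimal in \<open>U - L\<close>: its proper subsets lie
  in \<open>U\<close>, hence by minimality in \<open>L\<close>. Here \<open>L\<close> may be the
  empty collection.\<close>

lemma obtain_simplicial_insert:
  assumes "L \<in> simplicial_complexes n" "U \<in> simplicial_complexes n" "L \<subset> U"
  obtains A where "A \<in> U" "A \<notin> L" "insert A L \<in> simplicial_complexes n"
proof -
  have "finite (U - L)" "U - L \<noteq> {}"
    using assms finite_simplicial_complex by auto
  then obtain A where A: "A \<in> U - L" "\<And>B. B \<in> U - L \<Longrightarrow> B \<subseteq> A \<Longrightarrow> A = B"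
    using finite_has_minimal[of "U - L"] by metis
  have "insert A L \<in> simplicial_complexes n"
    unfolding simplicial_complexes_def
  proof (intro CollectI conjI ballI allI impI)
    show "insert A L \<subseteq> Pow {1..n}"
      using assms A(1) by (auto simp: simplicial_complexes_def)
    fix B D assume "D \<in> insert A L" "B \<subseteq> D"
    moreover have "B \<in> U" if "B \<subseteq> A"
      using that A(1) assms(2) by (auto simp: simplicial_complexes_def)
    ultimately show "B \<in> insert A L"
      using A(2)[of B] assms(1) by (auto simp: simplicial_complexes_def)
  qed
  with A(1) show thesis
    using that by blast
qed

lemma max_chain_comparable_mem:
  assumes C: "C \<in> max_chains n" and K: "K \<in> input_lattice n"
    and comp: "\<And>X. X \<in> C \<Longrightarrow> X \<subseteq> K \<or> K \<subseteq> X"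
  shows "K \<in> C"
proof (rule ccontr)
  assume "K \<notin> C"
  moreover have "subset.chain (input_lattice n) (insert K C)"
    using C K comp by (auto simp: max_chains_def subset.maxchain_def subset_chain_def)
  ultimately show False
    using C by (auto simp: max_chains_def subset.maxchain_def)
qed

text \<open>If level \<open>k\<close> were missing, then the largest member of size below \<open>k\<close> could be extended by a
  minimal player of the smallest member of size above \<open>k\<close>.\<close>

lemma max_chain_has_level:
  assumes C: "C \<in> max_chains n" and k: "k \<in> {1..card (Pow {1..n})}"
  shows "\<exists>K\<in>C. card K = k"
proof (rule ccontr)
  assume none: "\<not> ?thesis"
  have sub: "C \<subseteq> simplicial_complexes n"
    and linear: "\<And>X Y. X \<in> C \<Longrightarrow> Y \<in> C \<Longrightarrow> X \<subseteq> Y \<or> Y \<subseteq> X"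
    using C by (auto simp: max_chains_def subset.maxchain_def subset_chain_def input_lattice_def)
  have fin: "finite X" if "X \<in> C" for X
    using that sub finite_simplicial_complex by blast
  have finC: "finite C"
    using sub finite_simplicial_complexes finite_subset by blast
  have linear': "X \<subseteq> Y" if "X \<in> C" "Y \<in> C" "card X < card Y" for X Y
    using linear[OF that(1,2)] card_mono[OF fin[OF that(1)], of Y] that(3) by auto
  have top: "Pow {1..n} \<in> C"
  proof (rule max_chain_comparable_mem[OF C])
    show "Pow {1..n} \<in> input_lattice n"
      using Pow_in_simplicial_complexes by (auto simp: input_lattice_def)
    show "X \<subseteq> Pow {1..n} \<or> Pow {1..n} \<subseteq> X" if "X \<in> C" for X
      using sub that by (auto simp: simplicial_complexes_def)
  qed
  \<comment> \<open>By linearity this union is itself the largest member of size below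
    \<open>k\<close>, or the empty collection if there is none.\<close>
  define L where "L = \<Union>{X \<in> C. card X < k}"
  have L: "L \<in> simplicial_complexes n"
    unfolding L_def using sub by (intro simplicial_complex_Union) auto
  have L_cases: "L = {} \<or> L \<in> C \<and> card L < k"
  proof (cases "{X \<in> C. card X < k} = {}")
    case False
    then have "L \<in> {X \<in> C. card X < k}"
      unfolding L_def
    proof (rule finite_Sup_in[rotated])
      fix X Y assume XY: "X \<in> {X \<in> C. card X < k}" "Y \<in> {X \<in> C. card X < k}"
      then have "X \<union> Y = Y \<or> X \<union> Y = X"
        using linear[of X Y] by blast
      then show "sup X Y \<in> {X \<in> C. card X < k}"
        using XY by auto
    qed (use finC in simp)
    then show ?thesis
      by simp
  qed (auto simp: L_def)
  \<comment> \<open>Such members exist: the full power set is in \<open>C\<close>, and its size is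
    not \<open>k\<close> because level \<open>k\<close> is missing.\<close>
  define U where "U = (ARG_MIN card X. X \<in> C \<and> k < card X)"
  have "\<exists>X. X \<in> C \<and> k < card X"
    using top none k by (intro exI[of _ "Pow {1..n}"]) (metis atLeastAtMost_iff le_neq_implies_less)
  then have U: "U \<in> C" "k < card U"
    and U_min: "\<And>X. X \<in> C \<Longrightarrow> k < card X \<Longrightarrow> card U \<le> card X"
    unfolding U_def using arg_min_natI[of "\<lambda>X. X \<in> C \<and> k < card X" _ card]
      arg_min_nat_le[of "\<lambda>X. X \<in> C \<and> k < card X" _ card] by blast+
  have "card L < k"
    using L_cases k by auto
  have "L \<subset> U"
  proof -
    have "L \<subseteq> U"
      using L_cases linear'[of L U] U by auto
    then show ?thesis
      using U \<open>card L < k\<close> by auto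
  qed
  then obtain A where A: "A \<in> U" "A \<notin> L" "insert A L \<in> simplicial_complexes n"
    using obtain_simplicial_insert[OF L] U(1) sub by blast
  have "card (insert A L) = Suc (card L)"
    using A(2) L finite_simplicial_complex by simp
  moreover have "insert A L \<in> C"
  proof (rule max_chain_comparable_mem[OF C])
    show "insert A L \<in> input_lattice n"
      using A(3) by (simp add: input_lattice_def)
    fix X assume X: "X \<in> C"
    show "X \<subseteq> insert A L \<or> insert A L \<subseteq> X"
    proof (cases "card X < k")
      case True
      then show ?thesis
        using X by (auto simp: L_def)
    next
      case False
      then have "k < card X"
        using none X by (metis linorder_neqE_nat)
      then have "card U \<le> card X"
        using U_min X by blast
      then have "U \<subseteq> X"
        using linear[OF U(1) X] fin[OF U(1)] card_seteq[of U X] by blast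
      then show ?thesis
        using A(1) \<open>L \<subset> U\<close> by blast
    qed
  qed
  \<comment> \<open>The size is at most \<open>k\<close>, and no member has size \<open>k\<close>;
    so \<open>insert A L\<close> would be one of the sets united in \<open>L\<close>.\<close>
  ultimately have "insert A L \<in> {X \<in> C. card X < k}"
    using none \<open>card L < k\<close> by (auto intro: le_neq_implies_less)
  then have "insert A L \<subseteq> L"
    unfolding L_def by blast
  then show False
    using A(2) by blast
qed

text \<open>Rank a player by the size of the smallest member of \<open>C\<close> containing it. All
  sizes occur, so the chain adds one player at a time and its members are the prefixes.\<close>

lemma max_chain_eq_ranking_chain:
  assumes C: "C \<in> max_chains n"
  shows "\<exists>\<pi>\<in>feasible_rankings (Pow {1..n}). ranking_chain n \<pi> = C"
proof -
  let ?P = "Pow {1..n}" and ?N = "card (Pow {1..n})"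
  have sub: "C \<subseteq> simplicial_complexes n" "C \<subseteq> input_lattice n"
    and linear: "\<And>X Y. X \<in> C \<Longrightarrow> Y \<in> C \<Longrightarrow> X \<subseteq> Y \<or> Y \<subseteq> X"
    using C by (auto simp: max_chains_def subset.maxchain_def subset_chain_def input_lattice_def)
  have subP: "X \<subseteq> ?P" if "X \<in> C" for X
    using that sub by (auto simp: simplicial_complexes_def)
  have finC: "finite C"
    using sub finite_simplicial_complexes finite_subset by blast
  have fin: "finite X" if "X \<in> C" for X
    using that sub finite_simplicial_complex by blast
  define \<pi> where "\<pi> = (\<lambda>A\<in>?P. LEAST k. \<exists>X\<in>C. card X = k \<and> A \<in> X)"
  obtain T where T: "T \<in> C" "card T = ?N"
    using max_chain_has_level[OF C, of ?N] by (auto simp: Suc_le_eq card_gt_0_iff)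
  then have TP: "T = ?P"
    using subP card_subset_eq[of ?P T] by auto
  have ex: "\<exists>X\<in>C. card X = \<pi> A \<and> A \<in> X" if "A \<in> ?P" for A
  proof -
    have "\<exists>X\<in>C. card X = card T \<and> A \<in> X"
      using T TP that by blast
    then show ?thesis
      unfolding \<pi>_def using that by (simp del: Pow_iff) (rule LeastI)
  qed
  have le: "\<pi> A \<le> card X" if "X \<in> C" "A \<in> X" for A X
  proof -
    have "A \<in> ?P"
      using that subP by blast
    then show ?thesis
      unfolding \<pi>_def using that by (auto intro!: Least_le simp del: Pow_iff)
  qed
  \<comment> \<open>A member of size \<open>\<pi> A\<close> containing \<open>A\<close> lies below
    \<open>X\<close> as soon as \<open>\<pi> A\<close> is at most the size of \<open>X\<close>, by
    linearity.\<close>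
  have prefix: "ranking_prefix ?P \<pi> (card X) = X" if X: "X \<in> C" for X
  proof
    show "X \<subseteq> ranking_prefix ?P \<pi> (card X)"
      using le[OF X] subP[OF X] unfolding ranking_prefix_def by blast
    show "ranking_prefix ?P \<pi> (card X) \<subseteq> X"
    proof
      fix A assume "A \<in> ranking_prefix ?P \<pi> (card X)"
      then have A: "A \<in> ?P" "\<pi> A \<le> card X"
        by (auto simp: ranking_prefix_def)
      obtain Y where Y: "Y \<in> C" "card Y = \<pi> A" "A \<in> Y"
        using ex[OF A(1)] by blast
      then have "Y \<subseteq> X"
        using linear[OF X Y(1)] A(2) card_seteq[of Y X] fin by auto
      then show "A \<in> X"
        using Y(3) by blast
    qed
  qed
  have level: "\<exists>X\<in>C. card X = k \<and> ranking_prefix ?P \<pi> k = X" if "k \<in> {1..?N}" for k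
    using max_chain_has_level[OF C that] prefix by blast
  have pos: "1 \<le> \<pi> A" "\<pi> A \<le> ?N" if A: "A \<in> ?P" for A
  proof -
    obtain X where X: "X \<in> C" "card X = \<pi> A" "A \<in> X"
      using ex[OF A] by blast
    have "0 < card X"
      using X fin[OF X(1)] by (metis card_gt_0_iff empty_iff)
    then show "1 \<le> \<pi> A"
      using X(2) by simp
    have "card X \<le> ?N"
      using subP[OF X(1)] by (intro card_mono) auto
    then show "\<pi> A \<le> ?N"
      using X(2) by simp
  qed
  \<comment> \<open>The prefixes at \<open>k - 1\<close> and \<open>k\<close> differ in size, so
    some player has position exactly \<open>k\<close>. The case \<open>k = 1\<close> is separate
    because \<open>C\<close> has no member of size 0.\<close>
  have surj: "{1..?N} \<subseteq> \<pi> ` ?P"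
  proof
    fix k assume k: "k \<in> {1..?N}"
    obtain X where X: "X \<in> C" "card X = k" "ranking_prefix ?P \<pi> k = X"
      using level[OF k] by blast
    have "card (ranking_prefix ?P \<pi> (k - 1)) = k - 1"
    proof (cases "k = 1")
      case True
      have "\<not> \<pi> A \<le> k - 1" if "A \<in> ?P" for A
        using pos(1)[OF that] True by simp
      then have "ranking_prefix ?P \<pi> (k - 1) = {}"
        unfolding ranking_prefix_def by blast
      then show ?thesis
        using True by simp
    next
      case False
      then show ?thesis
        using level[of "k - 1"] k by fastforce
    qed
    moreover have "card (ranking_prefix ?P \<pi> k) = k" "k - 1 < k"
      using X k by auto
    ultimately have "ranking_prefix ?P \<pi> (k - 1) \<noteq> ranking_prefix ?P \<pi> k"
      by (metis order_less_irrefl)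
    moreover have "ranking_prefix ?P \<pi> (k - 1) \<subseteq> ranking_prefix ?P \<pi> k"
      by (rule ranking_prefix_mono) simp
    ultimately obtain A where "A \<in> ?P" "\<pi> A \<le> k" "\<not> \<pi> A \<le> k - 1"
      unfolding ranking_prefix_def by blast
    then have "\<pi> A = k"
      by linarith
    then show "k \<in> \<pi> ` ?P"
      using \<open>A \<in> ?P\<close> by blast
  qed
  have "\<pi> A \<in> {1..?N}" if "A \<in> ?P" for A
    using pos[OF that] unfolding atLeastAtMost_iff by blast
  then have img: "\<pi> ` ?P = {1..?N}"
    using surj by blast
  \<comment> \<open>Injectivity follows from surjectivity by counting.\<close>
  then have "card (\<pi> ` ?P) = ?N"
    by (simp only: card_atLeastAtMost diff_Suc_1)
  then have bij: "bij_betw \<pi> ?P {1..?N}"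
    unfolding bij_betw_def using img by (intro conjI eq_card_imp_inj_on) (simp_all only: finite_Pow_iff finite_atLeastAtMost)
  have "\<pi> B < \<pi> D" if BD: "B \<in> ?P" "D \<in> ?P" "B \<subset> D" for B D
  proof -
    obtain X where X: "X \<in> C" "card X = \<pi> D" "D \<in> X"
      using ex[OF BD(2)] by blast
    then have "B \<in> X"
      using sub(1) BD(3) by (auto simp: simplicial_complexes_def)
    then have "\<pi> B \<le> \<pi> D"
      using le X by metis
    moreover have "\<pi> B \<noteq> \<pi> D"
      using bij_betw_imp_inj_on[OF bij] BD by (auto dest: inj_onD)
    ultimately show ?thesis
      by simp
  qed
  moreover have "\<pi> \<in> extensional ?P"
    by (simp add: \<pi>_def)
  ultimately have \<pi>: "\<pi> \<in> feasible_rankings ?P"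
    using bij unfolding feasible_rankings_def by blast
  have "ranking_chain n \<pi> \<subseteq> C"
    using level by (auto simp: ranking_chain_def)
  moreover have "C \<subseteq> ranking_chain n \<pi>"
    using ranking_chain_iff[OF \<pi>] sub prefix by blast
  ultimately show ?thesis
    using \<pi> by blast
qed

section \<open>Counting maximal chains through an edge\<close>

lemma bij_betw_ranking_chain:
  "bij_betw (ranking_chain n) (feasible_rankings (Pow {1..n})) (max_chains n)"
  unfolding bij_betw_def
  using inj_on_ranking_chain ranking_chain_in_max_chains max_chain_eq_ranking_chain
  by blast

lemma card_max_chains: "card (max_chains n) = card (feasible_rankings (Pow {1..n}))"
  using bij_betw_same_card[OF bij_betw_ranking_chain] by metis

lemma card_max_chains_through:
  assumes K: "K \<in> input_lattice n" and K': "insert A K \<in> input_lattice n" and A: "A \<notin> K"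
  shows "card (max_chains_through n K (insert A K)) =
    card {\<pi> \<in> feasible_rankings (Pow {1..n}). ranking_prefix (Pow {1..n}) \<pi> (card K) = K \<and>
      ranking_prefix (Pow {1..n}) \<pi> (Suc (card K)) = insert A K}"
proof -
  let ?P = "Pow {1..n}"
  let ?R = "{\<pi> \<in> feasible_rankings ?P. ranking_prefix ?P \<pi> (card K) = K \<and>
      ranking_prefix ?P \<pi> (Suc (card K)) = insert A K}"
  have "finite K"
    using K by (auto simp: input_lattice_def intro: finite_simplicial_complex)
  then have card: "card (insert A K) = Suc (card K)"
    using A by simp
  \<comment> \<open>Nothing lies strictly between \<open>K\<close> and \<open>insert A K\<close>, so
    two members of this form are always consecutive.\<close>
  have "max_chains_through n K (insert A K) = {C \<in> max_chains n. K \<in> C \<and> insert A K \<in> C}"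
    using A by (auto simp: max_chains_through_def)
  also have "\<dots> = {C \<in> ranking_chain n ` feasible_rankings ?P. K \<in> C \<and> insert A K \<in> C}"
    using bij_betw_ranking_chain[of n] by (simp add: bij_betw_def)
  also have "\<dots> = ranking_chain n ` ?R"
    using ranking_chain_iff[OF _ K] ranking_chain_iff[OF _ K'] by (auto simp: card)
  finally show ?thesis
    using inj_on_ranking_chain[of n] by (simp add: card_image inj_on_subset)
qed

text \<open>Such a ranking splits into a ranking of \<open>K\<close>, the player \<open>A\<close> at position \<open>card K + 1\<close>, and a
  shifted ranking of the remaining players.\<close>

lemma card_rankings_through:
  assumes K: "K \<in> simplicial_complexes n" and K': "insert A K \<in> simplicial_complexes n"
    and A: "A \<notin> K"
  shows "card {\<pi> \<in> feasible_rankings (Pow {1..n}). ranking_prefix (Pow {1..n}) \<pi> (card K) = K \<and>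
      ranking_prefix (Pow {1..n}) \<pi> (Suc (card K)) = insert A K} =
    card (feasible_rankings K) * card (feasible_rankings (Pow {1..n} - insert A K))"
proof -
  define P where "P = Pow {1..n}"
  define Q where "Q = P - insert A K"
  define k where "k = card K"
  define N where "N = card P"
  define R where "R = {\<pi> \<in> feasible_rankings P. ranking_prefix P \<pi> k = K \<and>
      ranking_prefix P \<pi> (Suc k) = insert A K}"
  \<comment> \<open>The shift by \<open>Suc k\<close> puts the players of \<open>Q\<close> after
    those of \<open>K\<close> and \<open>A\<close>; restriction to \<open>P\<close> keeps the result
    extensional.\<close>
  define join where "join = (\<lambda>(\<sigma>::nat set \<Rightarrow> nat, \<tau>::nat set \<Rightarrow> nat). \<lambda>B\<in>P.
      if B \<in> K then \<sigma> B else if B = A then Suc k else Suc k + \<tau> B)"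
  \<comment> \<open>The inverse of \<open>join\<close>: on \<open>Q\<close> positions exceed
    \<open>Suc k\<close>, so the truncated subtraction is exact and preserves strict order.\<close>
  define cut where "cut = (\<lambda>\<pi>::nat set \<Rightarrow> nat. (restrict \<pi> K, \<lambda>B\<in>Q. \<pi> B - Suc k))"
  have finP: "finite P"
    by (simp add: P_def)
  have P_eq: "P = K \<union> {A} \<union> Q"
    using K K' by (auto simp: P_def Q_def simplicial_complexes_def)
  have disj: "K \<inter> Q = {}" "A \<notin> Q"
    by (auto simp: Q_def)
  have fin: "finite K" "finite Q"
    using finP P_eq by (metis finite_Un)+
  have N_eq: "N = Suc k + card Q"
    unfolding N_def P_eq k_def using fin disj A by (simp add: card_Un_disjoint)
  have down: "B \<in> K" if "D \<in> K" "B \<subset> D" for B D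
    using K that by (auto simp: simplicial_complexes_def)
  have down': "B \<in> insert A K" if "D \<in> insert A K" "B \<subset> D" for B D
    using K' that unfolding simplicial_complexes_def by blast
  have R_iff: "\<pi> B \<le> k \<longleftrightarrow> B \<in> K" "\<pi> B \<le> Suc k \<longleftrightarrow> B \<in> insert A K"
    if "\<pi> \<in> R" "B \<in> P" for \<pi> B
    using that by (auto simp: R_def ranking_prefix_def)
  have R_A: "\<pi> A = Suc k" if "\<pi> \<in> R" for \<pi>
    using R_iff[OF that, of A] P_eq A by auto
  have "bij_betw join (feasible_rankings K \<times> feasible_rankings Q) R"
  proof (rule bij_betw_byWitness[of _ cut])
    show "\<forall>s\<in>feasible_rankings K \<times> feasible_rankings Q. cut (join s) = s"
    proof clarify
      fix \<sigma> \<tau> assume "\<sigma> \<in> feasible_rankings K" "\<tau> \<in> feasible_rankings Q"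
      then have "\<sigma> \<in> extensional K" "\<tau> \<in> extensional Q"
        by (auto simp: feasible_rankings_def)
      then have "restrict (join (\<sigma>, \<tau>)) K = \<sigma>" "(\<lambda>B\<in>Q. join (\<sigma>, \<tau>) B - Suc k) = \<tau>"
        using P_eq disj by (auto simp: join_def extensional_def restrict_def fun_eq_iff)
      then show "cut (join (\<sigma>, \<tau>)) = (\<sigma>, \<tau>)"
        by (simp add: cut_def)
    qed
    show "\<forall>\<pi>\<in>R. join (cut \<pi>) = \<pi>"
    proof
      fix \<pi> assume \<pi>: "\<pi> \<in> R"
      show "join (cut \<pi>) = \<pi>"
      proof (rule extensionalityI[of _ P])
        show "\<pi> \<in> extensional P"
          using \<pi> by (simp add: R_def feasible_rankings_def)
        fix B assume B: "B \<in> P"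
        then consider "B \<in> K" | "B = A" | "B \<in> Q"
          using P_eq by blast
        then show "join (cut \<pi>) B = \<pi> B"
        proof cases
          case 1
          then show ?thesis
            using B by (simp add: join_def cut_def)
        next
          case 2
          then show ?thesis
            using A B R_A[OF \<pi>] by (simp add: join_def cut_def)
        next
          case 3
          then have "B \<notin> K" "B \<noteq> A"
            by (auto simp: Q_def)
          moreover from this have "Suc k < \<pi> B"
            using R_iff(2)[OF \<pi> B] by simp
          ultimately show ?thesis
            using 3 B by (simp add: join_def cut_def)
        qed
      qed (simp add: join_def cut_def)
    qed
    show "join ` (feasible_rankings K \<times> feasible_rankings Q) \<subseteq> R"
    proof clarify
      fix \<sigma> \<tau> assume \<sigma>: "\<sigma> \<in> feasible_rankings K" and \<tau>: "\<tau> \<in> feasible_rankings Q"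
      define \<pi> where "\<pi> = join (\<sigma>, \<tau>)"
      have \<pi>_K: "\<pi> B = \<sigma> B" if "B \<in> K" for B
        using that P_eq by (simp add: \<pi>_def join_def)
      have \<pi>_A: "\<pi> A = Suc k"
        using A P_eq by (simp add: \<pi>_def join_def)
      have \<pi>_Q: "\<pi> B = Suc k + \<tau> B" if "B \<in> Q" for B
        using that disj P_eq by (auto simp: \<pi>_def join_def)
      have bij\<sigma>: "bij_betw \<sigma> K {1..k}" and bij\<tau>: "bij_betw \<tau> Q {1..card Q}"
        using \<sigma> \<tau> by (auto simp: feasible_rankings_def k_def)
      have "bij_betw \<pi> K {1..k}"
        using bij\<sigma> by (simp add: bij_betw_cong[OF \<pi>_K])
      moreover have "bij_betw \<pi> {A} {Suc k}"
        by (simp add: \<pi>_A bij_betw_def)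
      ultimately have "bij_betw \<pi> (K \<union> {A}) ({1..k} \<union> {Suc k})"
        by (rule bij_betw_combine) simp
      moreover have "bij_betw \<pi> Q {Suc (Suc k)..N}"
      proof -
        have "bij_betw ((+) (Suc k)) {1..card Q} {Suc (Suc k)..N}"
          by (rule bij_betw_byWitness[of _ "\<lambda>i. i - Suc k"]) (auto simp: N_eq)
        then have "bij_betw ((+) (Suc k) \<circ> \<tau>) Q {Suc (Suc k)..N}"
          using bij\<tau> by (rule bij_betw_trans[rotated])
        then show ?thesis
          by (rule bij_betw_cong[THEN iffD1, rotated]) (simp add: \<pi>_Q)
      qed
      ultimately have "bij_betw \<pi> (K \<union> {A} \<union> Q) ({1..k} \<union> {Suc k} \<union> {Suc (Suc k)..N})"
        by (rule bij_betw_combine) auto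
      moreover have "{1..k} \<union> {Suc k} \<union> {Suc (Suc k)..N} = {1..N}"
        using N_eq by auto
      ultimately have bij: "bij_betw \<pi> P {1..card P}"
        by (simp only: P_eq[symmetric] N_def)
      have \<sigma>_le: "\<sigma> B \<le> k" if "B \<in> K" for B
        using bij_betw_apply[OF bij\<sigma> that] by simp
      have \<tau>_ge: "1 \<le> \<tau> B" if "B \<in> Q" for B
        using bij_betw_apply[OF bij\<tau> that] by simp
      have "\<pi> B < \<pi> D" if BD: "B \<in> P" "D \<in> P" "B \<subset> D" for B D
      proof -
        \<comment> \<open>Downward closure of \<open>K\<close> and \<open>insert A K\<close>
          excludes that \<open>D\<close> lies in an earlier block than its proper subset
          \<open>B\<close>.\<close>
        consider "D \<in> K" | "D = A" | "D \<in> Q"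
          using BD P_eq by blast
        then show ?thesis
        proof cases
          case 1
          then have "B \<in> K"
            using down BD by blast
          then show ?thesis
            using 1 \<sigma> BD by (auto simp: \<pi>_K feasible_rankings_def)
        next
          case 2
          then have "B \<in> K"
            using down'[of D B] BD by auto
          then show ?thesis
            using 2 \<sigma>_le[of B] by (simp add: \<pi>_K \<pi>_A)
        next
          case 3
          consider "B \<in> K" | "B = A" | "B \<in> Q"
            using BD P_eq by blast
          then show ?thesis
          proof cases
            case 1
            then show ?thesis
              using 3 \<sigma>_le[of B] by (simp add: \<pi>_K \<pi>_Q)
          next
            case 2
            then show ?thesis
              using 3 \<tau>_ge[of D] by (simp add: \<pi>_A \<pi>_Q)
          next
            case B: 3
            then show ?thesis
              using 3 \<tau> BD by (auto simp: \<pi>_Q feasible_rankings_def)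
          qed
        qed
      qed
      then have "\<pi> \<in> feasible_rankings P"
        using bij by (auto simp: feasible_rankings_def \<pi>_def join_def)
      moreover have "ranking_prefix P \<pi> k = K"
        unfolding ranking_prefix_def P_eq using \<sigma>_le by (auto simp: \<pi>_K \<pi>_A \<pi>_Q)
      moreover have "ranking_prefix P \<pi> (Suc k) = insert A K"
      proof -
        have "\<pi> B \<le> Suc k \<longleftrightarrow> B \<in> insert A K" if "B \<in> P" for B
        proof (cases "B \<in> Q")
          case True
          then show ?thesis
            using disj \<tau>_ge[of B] by (auto simp: \<pi>_Q)
        next
          case False
          then have "B \<in> insert A K"
            using P_eq that by blast
          then show ?thesis
            using \<sigma>_le by (auto simp: \<pi>_K \<pi>_A le_SucI)
        qed
        then show ?thesis
          unfolding ranking_prefix_def using P_eq by blast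
      qed
      ultimately show "join (\<sigma>, \<tau>) \<in> R"
        by (simp add: R_def \<pi>_def)
    qed
    show "cut ` R \<subseteq> feasible_rankings K \<times> feasible_rankings Q"
    proof clarify
      fix \<pi> \<sigma> \<tau> assume \<pi>: "\<pi> \<in> R" and cut: "(\<sigma>, \<tau>) = cut \<pi>"
      then have \<sigma>_eq: "\<sigma> = restrict \<pi> K" and \<tau>_eq: "\<tau> = (\<lambda>B\<in>Q. \<pi> B - Suc k)"
        by (auto simp: cut_def)
      have bij: "bij_betw \<pi> P {1..N}"
        and mono: "\<And>B D. B \<in> P \<Longrightarrow> D \<in> P \<Longrightarrow> B \<subset> D \<Longrightarrow> \<pi> B < \<pi> D"
        using \<pi> by (auto simp: R_def feasible_rankings_def N_def)
      have img: "\<pi> ` K = {1..k}" "\<pi> ` insert A K = {1..Suc k}"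
        using \<pi> bij N_eq image_ranking_prefix[of \<pi> P k] image_ranking_prefix[of \<pi> P "Suc k"]
        unfolding R_def N_def by auto
      have inj: "inj_on \<pi> P"
        using bij by (simp add: bij_betw_def)
      \<comment> \<open>By injectivity, \<open>Q\<close> takes exactly the positions left over by
        \<open>K\<close> and \<open>A\<close>.\<close>
      have imgQ: "\<pi> ` Q = {Suc (Suc k)..N}"
      proof -
        have "\<pi> ` Q = \<pi> ` P - \<pi> ` insert A K"
          unfolding Q_def by (rule inj_on_image_set_diff[OF inj]) (use P_eq in auto)
        also have "\<dots> = {1..N} - {1..Suc k}"
          using bij by (simp only: img bij_betw_def)
        also have "\<dots> = {Suc (Suc k)..N}"
          by auto
        finally show ?thesis .
      qed
      have bijQ: "bij_betw \<pi> Q {Suc (Suc k)..N}"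
        using imgQ inj P_eq by (auto simp: bij_betw_def intro: inj_on_subset)
      have Q_gt: "Suc k < \<pi> B" if "B \<in> Q" for B
        using bij_betw_apply[OF bijQ that] by simp
      have "bij_betw \<pi> K {1..k}"
        using img inj P_eq by (auto simp: bij_betw_def intro: inj_on_subset)
      then have "bij_betw \<sigma> K {1..k}"
        by (rule bij_betw_cong[THEN iffD1, rotated]) (simp add: \<sigma>_eq)
      moreover have "\<sigma> B < \<sigma> D" if "B \<in> K" "D \<in> K" "B \<subset> D" for B D
        using mono[of B D] that P_eq by (simp add: \<sigma>_eq)
      ultimately have \<sigma>: "\<sigma> \<in> feasible_rankings K"
        by (auto simp: feasible_rankings_def \<sigma>_eq k_def)
      have "bij_betw (\<lambda>i. i - Suc k) {Suc (Suc k)..N} {1..card Q}"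
        by (rule bij_betw_byWitness[of _ "\<lambda>i. i + Suc k"]) (auto simp: N_eq)
      then have "bij_betw ((\<lambda>i. i - Suc k) \<circ> \<pi>) Q {1..card Q}"
        using bijQ by (rule bij_betw_trans[rotated])
      then have "bij_betw \<tau> Q {1..card Q}"
        by (rule bij_betw_cong[THEN iffD1, rotated]) (simp add: \<tau>_eq)
      moreover have "\<tau> B < \<tau> D" if "B \<in> Q" "D \<in> Q" "B \<subset> D" for B D
        using mono[of B D] that P_eq Q_gt[of B] by (auto simp: \<tau>_eq intro!: diff_less_mono)
      ultimately have "\<tau> \<in> feasible_rankings Q"
        by (auto simp: feasible_rankings_def \<tau>_eq)
      with \<sigma> show "\<sigma> \<in> feasible_rankings K \<and> \<tau> \<in> feasible_rankings Q"
        by blast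
    qed
  qed
  from bij_betw_same_card[OF this] show ?thesis
    by (simp add: card_cartesian_product R_def P_def Q_def k_def)
qed

text \<open>A uniform edge weight is the proportion of maximal chains through the edge, and both
  counts are counts of rankings.\<close>

lemma edge_weight_uniform:
  assumes "K \<in> input_lattice n" "insert A K \<in> input_lattice n" "A \<notin> K"
  shows "edge_weight n (uniform_weighting n) K (insert A K) =
    real (card (feasible_rankings K)) * real (card (feasible_rankings (Pow {1..n} - insert A K)))
      / real (card (feasible_rankings (Pow {1..n})))"
proof -
  have "K \<in> simplicial_complexes n" "insert A K \<in> simplicial_complexes n"
    using assms by (auto simp: input_lattice_def)
  then show ?thesis
    unfolding edge_weight_def uniform_weighting_def
    by (simp only: sum_constant card_max_chains card_max_chains_through[OF assms]
        card_rankings_through[OF _ _ assms(3)]) simp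
qed

section \<open>Edges as coalitions with a marked maximal player\<close>

lemma simplicial_complex_remove_maximal:
  assumes "K \<in> simplicial_complexes n" "A \<in> maximal_elements K"
  shows "K - {A} \<in> simplicial_complexes n"
  unfolding simplicial_complexes_def
proof (intro CollectI conjI ballI allI impI)
  show "K - {A} \<subseteq> Pow {1..n}"
    using assms(1) unfolding simplicial_complexes_def by blast
  fix B D assume D: "D \<in> K - {A}" "B \<subseteq> D"
  then have "B \<in> K"
    using assms(1) unfolding simplicial_complexes_def by blast
  moreover have "\<not> A \<subset> D"
    using assms(2) D(1) unfolding maximal_elements_def by blast
  ultimately show "B \<in> K - {A}"
    using D by blast
qed

text \<open>A member of \<open>K\<close> strictly above \<open>A\<close> would force
  \<open>A\<close> into \<open>K\<close>.\<close>

lemma maximal_in_insert: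
  assumes "K \<in> simplicial_complexes n" "A \<notin> K"
  shows "A \<in> maximal_elements (insert A K)"
proof -
  have "\<not> A \<subset> B" if "B \<in> K" for B
    using assms that unfolding simplicial_complexes_def by blast
  then show ?thesis
    unfolding maximal_elements_def by blast
qed

text \<open>For non-empty \<open>A\<close> the collection \<open>K - {A}\<close> still contains
  \<open>{}\<close> and thus stays in the input lattice. For \<open>A = {}\<close> the coalition
  \<open>{{}}\<close> would have no edge.\<close>

lemma bij_betw_edges:
  assumes "A \<noteq> {}"
  shows "bij_betw (\<lambda>K. (K - {A}, K)) {K \<in> simplicial_complexes n. A \<in> maximal_elements K} (edges n A)"
proof (rule bij_betw_byWitness[of _ snd])
  show "(\<lambda>K. (K - {A}, K)) ` {K \<in> simplicial_complexes n. A \<in> maximal_elements K} \<subseteq> edges n A"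
  proof clarify
    fix K assume K: "K \<in> simplicial_complexes n" "A \<in> maximal_elements K"
    then have "A \<in> K" "{} \<in> K"
      by (auto simp: maximal_elements_def simplicial_complexes_def)
    then show "(K - {A}, K) \<in> edges n A"
      using K assms simplicial_complex_remove_maximal[OF K]
      by (auto simp: edges_def input_lattice_def)
  qed
  show "snd ` edges n A \<subseteq> {K \<in> simplicial_complexes n. A \<in> maximal_elements K}"
    using maximal_in_insert by (auto simp: edges_def input_lattice_def)
  show "\<forall>e\<in>edges n A. (snd e - {A}, snd e) = e"
    unfolding edges_def by force
qed simp

section \<open>Information contributions as Shapley values\<close>

theorem theorem2:
  fixes b :: real and n :: nat and S :: "nat \<Rightarrow> 'a set" and T :: "'b set"
    and p :: "((nat \<Rightarrow> 'a) \<times> 'b) pmf" and A :: "nat set"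
  assumes "1 < b" and "1 \<le> n"
    and "\<And>i. i \<in> {1..n} \<Longrightarrow> finite (S i)" and "finite T"
    and "set_pmf p \<subseteq> joint_states n S T"
    and "A \<subseteq> {1..n}"
  shows "information_contribution b n S T p (uniform_weighting n) A =
         shapley_precedence n (information_game b n S T p) A"
proof -
  have J: "finite (joint_states n S T)"
    using assms(3,4) by (rule finite_joint_states)
  note KL = KL_split_dist[OF assms(1) J assms(5)]
  show ?thesis
  proof (cases "A = {}")
    case True
    then have "edges n A = {}"
      using empty_set_in_input_lattice by (auto simp: edges_def)
    moreover have "information_game b n S T p K - information_game b n S T p (K - {A}) = 0"
      if "K \<in> simplicial_complexes n" "A \<in> maximal_elements K" for K
    proof -
      \<comment> \<open>The empty set is maximal only in this complex, whose value is the divergence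
        of a distribution from itself, hence 0, like the value of the empty coalition.\<close>
      have "K = {{}}"
        using that True by (auto simp: maximal_elements_def)
      then show ?thesis
        using True KL[of "{{}}" "{{}}"] by (simp add: information_game_def)
    qed
    ultimately show ?thesis
      by (simp add: information_contribution_def shapley_precedence_def)
  next
    case False
    let ?R = "\<lambda>P. real (card (feasible_rankings P))" and ?v = "information_game b n S T p"
      and ?p = "split_dist b n S T p"
    have "information_contribution b n S T p (uniform_weighting n) A =
      (\<Sum>K\<in>{K \<in> simplicial_complexes n. A \<in> maximal_elements K}.
        edge_weight n (uniform_weighting n) (K - {A}) K * KL_pmf b (?p K) (?p (K - {A})))"
      unfolding information_contribution_def
      by (subst sum.reindex_bij_betw[OF bij_betw_edges[OF False], symmetric]) simp
    also have "\<dots> = shapley_precedence n ?v A"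
      unfolding shapley_precedence_def
    proof (intro sum.cong refl)
      fix K assume "K \<in> {K \<in> simplicial_complexes n. A \<in> maximal_elements K}"
      then have "(K - {A}, K) \<in> edges n A"
        using bij_betw_apply[OF bij_betw_edges[OF False]] by fast
      then have K: "K - {A} \<in> input_lattice n" "K \<in> input_lattice n" "insert A (K - {A}) = K"
        by (auto simp: edges_def)
      then have sub: "{{}} \<subseteq> K - {A}" "{{}} \<subseteq> K" "K \<noteq> {}" "K - {A} \<noteq> {}"
        using empty_set_in_input_lattice by blast+
      have "edge_weight n (uniform_weighting n) (K - {A}) K =
          ?R (K - {A}) * ?R (Pow {1..n} - K) / ?R (Pow {1..n})"
        using edge_weight_uniform[of "K - {A}" n A] K by simp
      \<comment> \<open>Both values are entropy drops from \<open>{{}}\<close>, so their difference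
        is the entropy drop along the edge. Neither coalition is empty, so the default value 0 does
        not interfere.\<close>
      moreover have "KL_pmf b (?p K) (?p (K - {A})) = ?v K - ?v (K - {A})"
        using sub(3,4) KL[OF sub(1)] KL[OF sub(2)] KL[of "K - {A}" K]
        by (auto simp: information_game_def)
      ultimately show "edge_weight n (uniform_weighting n) (K - {A}) K * KL_pmf b (?p K) (?p (K - {A})) =
          ?R (K - {A}) * ?R (Pow {1..n} - K) / ?R (Pow {1..n}) * (?v K - ?v (K - {A}))"
        by simp
    qed
    finally show ?thesis .
  qed
qed

end
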